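(* Let $\mathbb{F}$ be an infinite field of arbitrary characteristic. Assume $f\in\mathbb{F}\langle X\rangle$ is a multihomogeneous polynomial identity for $\mathsf{A}_1^{(-,1)}$ of multidegree $(2,2)$ (in the variables $x_1,x_2$). Then $f=\alpha\,\Phi_{22}$ for some $\alpha\in\mathbb{F}$, where $$\Phi_{22}= x_1^2 x_2^2 - 3 x_1 x_2 x_1 x_2 + 2 x_1 x_2^2 x_1 + 2 x_2 x_1^2 x_2 - 3 x_2 x_1 x_2 x_1 + x_2^2 x_1^2.$$
   Context: $\mathbb{F}\langle X\rangle$ is the free unital associative $\mathbb{F}$-algebra on $X=\{x_1,x_2,\dots\}$. The Weyl algebra $\mathsf{A}_1$ is the unital associative $\mathbb{F}$-algebra generated by $x,y$ with defining relation $yx=xy+1$, and $\mathsf{A}_1^{(-,1)}\subset\mathsf{A}_1$ is the $\mathbb{F}$-linear span of all elements $ay$ with $a\in\mathbb{F}[x]$. An element $f(x_1,\dots,x_m)\in\mathbb{F}\langle X\rangle$ is a polynomial identity for a subspace $\mathcal{V}$ of an associative algebra $\mathcal{A}$ if $f(a_1,\dots,a_m)=0$ in $\mathcal{A}$ for all $a_1,\dots,a_m\in\mathcal{V}$. The multidegree of a monomial $w$ in $x_1,\dots,x_m$ is $(\deg_{x_1}w,\dots,\deg_{x_m}w)$; an element is multihomogeneous of a given multidegree if it is a linear combination of monomials of that multidegree. *)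

theory Defs
  imports "HOL-Library.Poly_Mapping" "HOL-Computational_Algebra.Polynomial"
begin

section \<open>The free monoid and the free unital associative algebra\<close>

text \<open>
  Words are wrapped in a datatype so that they can be given the (noncommutative) additive
  monoid structure which \<^theory>\<open>HOL-Library.Poly_Mapping\<close> requires of exponents: concatenation
  is written \<open>+\<close> and the empty word is \<open>0\<close>. The convolution product on finitely supported
  functions on words is then the product of the free algebra.
\<close>

datatype 'v free_monoid = Word (letters: "'v list")

instantiation free_monoid :: (type) monoid_add
begin

definition zero_free_monoid :: "'a free_monoid"
  where "0 = Word []"

definition plus_free_monoid :: "'a free_monoid \<Rightarrow> 'a free_monoid \<Rightarrow> 'a free_monoid"
  where "v + w = Word (letters v @ letters w)"

instance
  by standard (simp_all add: zero_free_monoid_def plus_free_monoid_def)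

end

type_synonym ('v, 'a) free_algebra = "'v free_monoid \<Rightarrow>\<^sub>0 'a"

definition free_monom :: "'v list \<Rightarrow> ('v, 'a::field) free_algebra"
  where "free_monom w = Poly_Mapping.single (Word w) 1"

definition free_gen :: "'v \<Rightarrow> ('v, 'a::field) free_algebra"
  where "free_gen v = free_monom [v]"

definition free_scale :: "'a::field \<Rightarrow> ('v, 'a) free_algebra \<Rightarrow> ('v, 'a) free_algebra"
  where "free_scale c f = Poly_Mapping.map ((*) c) f"

lemma free_scale_conv_mult: "free_scale c f = Poly_Mapping.single 0 c * f"
  by (simp add: free_scale_def mult_map_scale_conv_mult)

lemma lookup_free_scale: "Poly_Mapping.lookup (free_scale c f) w = c * Poly_Mapping.lookup f w"
  by (simp add: free_scale_def Poly_Mapping.map.rep_eq when_def)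

lemma poly_mapping_single_add_induct [case_names single sum]:
  fixes f :: "'w \<Rightarrow>\<^sub>0 'a::monoid_add"
  assumes single: "\<And>w a. P (Poly_Mapping.single w a)"
    and sum: "\<And>f g. P f \<Longrightarrow> P g \<Longrightarrow> P (f + g)"
  shows "P f"
proof (induction f rule: update_induct)
  case const
  show ?case using single[of undefined 0] by simp
next
  case (update f w a)
  then have "Poly_Mapping.update w a f = Poly_Mapping.single w a + f"
    by (intro poly_mapping_eqI) (auto simp: lookup_update lookup_add lookup_single in_keys_iff)
  with update single sum show ?case by simp
qed

lemma free_scale_mult_right: "f * free_scale c g = free_scale c (f * g)"
proof -
  have comm: "f * Poly_Mapping.single 0 c = Poly_Mapping.single 0 c * f"
  proof (induction f rule: poly_mapping_single_add_induct)
    case (single w a)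
    then show ?case by (simp add: mult_single mult.commute)
  next
    case (sum f g)
    then show ?case by (simp add: distrib_left distrib_right)
  qed
  show ?thesis
    by (simp add: free_scale_conv_mult comm flip: mult.assoc)
qed

interpretation free: vector_space free_scale
  by standard (auto intro!: poly_mapping_eqI simp: lookup_free_scale lookup_add algebra_simps)

text \<open>
  Multidegrees of elements in the variables with indices below \<open>length d\<close>: a monomial involving
  any other variable does not have multidegree \<open>d\<close>.
\<close>

definition has_multidegree :: "nat list \<Rightarrow> nat list \<Rightarrow> bool"
  where "has_multidegree d w \<longleftrightarrow>
    set w \<subseteq> {..<length d} \<and> (\<forall>i<length d. count_list w i = d ! i)"

definition multihomogeneous :: "nat list \<Rightarrow> (nat, 'a::field) free_algebra \<Rightarrow> bool"
  where "multihomogeneous d f \<longleftrightarrow> f \<in> free.span {free_monom w |w. has_multidegree d w}"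


section \<open>Polynomial identities of a subspace of an associative algebra\<close>

text \<open>
  The algebra is a unital ring type with scalar multiplication \<open>scale\<close>. An identity is tested
  on assignments of all generators; those not occurring in \<open>f\<close> do not affect the value.
\<close>

definition evaluate ::
    "('a::field \<Rightarrow> 'b \<Rightarrow> 'b) \<Rightarrow> ('v \<Rightarrow> 'b::ring_1) \<Rightarrow> ('v, 'a) free_algebra \<Rightarrow> 'b"
  where "evaluate scale a f =
    (\<Sum>w \<in> Poly_Mapping.keys f. scale (Poly_Mapping.lookup f w) (prod_list (map a (letters w))))"

definition polynomial_identity ::
    "('a::field \<Rightarrow> 'b \<Rightarrow> 'b) \<Rightarrow> 'b::ring_1 set \<Rightarrow> ('v, 'a) free_algebra \<Rightarrow> bool"
  where "polynomial_identity scale V f \<longleftrightarrow>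
    (\<forall>a. (\<forall>v. a v \<in> V) \<longrightarrow> evaluate scale a f = 0)"


section \<open>The Weyl algebra\<close>

inductive_set two_sided_ideal :: "'r::ring_1 set \<Rightarrow> 'r set" for S
  where
    zero: "0 \<in> two_sided_ideal S"
  | generator: "s \<in> S \<Longrightarrow> r * s * t \<in> two_sided_ideal S"
  | add: "a \<in> two_sided_ideal S \<Longrightarrow> b \<in> two_sided_ideal S \<Longrightarrow> a + b \<in> two_sided_ideal S"

lemma two_sided_ideal_mult_left:
  "a \<in> two_sided_ideal S \<Longrightarrow> r * a \<in> two_sided_ideal S"
proof (induction rule: two_sided_ideal.induct)
  case (generator s r' t)
  then show ?case
    using two_sided_ideal.generator[of s S "r * r'" t] by (simp add: mult.assoc)
qed (auto simp: distrib_left intro: two_sided_ideal.intros)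

lemma two_sided_ideal_mult_right:
  "a \<in> two_sided_ideal S \<Longrightarrow> a * r \<in> two_sided_ideal S"
proof (induction rule: two_sided_ideal.induct)
  case (generator s r' t)
  then show ?case
    using two_sided_ideal.generator[of s S r' "t * r"] by (simp add: mult.assoc)
qed (auto simp: distrib_right intro: two_sided_ideal.intros)

lemma two_sided_ideal_uminus:
  "a \<in> two_sided_ideal S \<Longrightarrow> - a \<in> two_sided_ideal S"
  using two_sided_ideal_mult_left[of a S "- 1"] by simp

datatype weyl_gen = Gen_x | Gen_y

definition weyl_relation :: "(weyl_gen, 'a::field) free_algebra"
  where "weyl_relation =
    free_gen Gen_y * free_gen Gen_x - (free_gen Gen_x * free_gen Gen_y + 1)"

definition weyl_cong ::
    "(weyl_gen, 'a::field) free_algebra \<Rightarrow> (weyl_gen, 'a) free_algebra \<Rightarrow> bool"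
  where "weyl_cong f g \<longleftrightarrow> f - g \<in> two_sided_ideal {weyl_relation}"

lemma equivp_weyl_cong: "equivp weyl_cong"
proof (rule equivpI)
  show "reflp weyl_cong"
    by (simp add: reflp_def weyl_cong_def two_sided_ideal.zero)
  show "symp weyl_cong"
    unfolding symp_def weyl_cong_def using two_sided_ideal_uminus by fastforce
  show "transp weyl_cong"
    unfolding transp_def weyl_cong_def using two_sided_ideal.add by fastforce
qed

text \<open>
  That the quotient is not the zero ring follows from its action on polynomials, with \<open>x\<close> acting
  by multiplication and \<open>y\<close> by differentiation. This action is not faithful in positive
  characteristic, so it cannot serve as the definition of the algebra.
\<close>

primrec weyl_act_gen :: "weyl_gen \<Rightarrow> 'a::field poly \<Rightarrow> 'a poly"
  where
    "weyl_act_gen Gen_x p = pCons 0 p"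
  | "weyl_act_gen Gen_y p = pderiv p"

definition weyl_act_word :: "weyl_gen list \<Rightarrow> 'a::field poly \<Rightarrow> 'a poly"
  where "weyl_act_word w p = foldr weyl_act_gen w p"

definition weyl_act :: "(weyl_gen, 'a::field) free_algebra \<Rightarrow> 'a poly \<Rightarrow> 'a poly"
  where "weyl_act f p = (\<Sum>w \<in> Poly_Mapping.keys f. smult (Poly_Mapping.lookup f w) (weyl_act_word (letters w) p))"

lemma weyl_act_word_append: "weyl_act_word (v @ w) p = weyl_act_word v (weyl_act_word w p)"
  by (simp add: weyl_act_word_def)

lemma weyl_act_word_add: "weyl_act_word w (p + q) = weyl_act_word w p + weyl_act_word w q"
proof (induction w)
  case (Cons v w)
  then show ?case by (cases v) (simp_all add: weyl_act_word_def pderiv_add)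
qed (simp add: weyl_act_word_def)

lemma weyl_act_word_smult: "weyl_act_word w (smult c p) = smult c (weyl_act_word w p)"
proof (induction w)
  case (Cons v w)
  then show ?case by (cases v) (simp_all add: weyl_act_word_def pderiv_smult)
qed (simp add: weyl_act_word_def)

lemma weyl_act_superset:
  assumes "finite A" "Poly_Mapping.keys f \<subseteq> A"
  shows "weyl_act f p = (\<Sum>w \<in> A. smult (Poly_Mapping.lookup f w) (weyl_act_word (letters w) p))"
  unfolding weyl_act_def
  by (rule sum.mono_neutral_left) (use assms in \<open>auto simp: in_keys_iff\<close>)

lemma weyl_act_add: "weyl_act (f + g) p = weyl_act f p + weyl_act g p"
proof -
  let ?A = "Poly_Mapping.keys f \<union> Poly_Mapping.keys g"
  have "Poly_Mapping.keys (f + g) \<subseteq> ?A" by (rule Poly_Mapping.keys_add)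
  then show ?thesis
    using weyl_act_superset[of ?A "f + g" p] weyl_act_superset[of ?A f p]
      weyl_act_superset[of ?A g p]
    by (simp add: lookup_add smult_add_left sum.distrib)
qed

lemma weyl_act_zero: "weyl_act 0 p = 0"
  by (simp add: weyl_act_def)

lemma weyl_act_diff: "weyl_act (f - g) p = weyl_act f p - weyl_act g p"
  using weyl_act_add[of "f - g" g p] by simp

lemma weyl_act_single:
  "weyl_act (Poly_Mapping.single w c) p = smult c (weyl_act_word (letters w) p)"
  by (cases "c = 0") (simp_all add: weyl_act_def)

lemma weyl_act_add_right: "weyl_act f (p + q) = weyl_act f p + weyl_act f q"
  by (simp add: weyl_act_def weyl_act_word_add smult_add_right sum.distrib)

lemma weyl_act_smult: "weyl_act f (smult c p) = smult c (weyl_act f p)"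
proof (induction f rule: poly_mapping_single_add_induct)
  case (single w a)
  then show ?case by (simp add: weyl_act_single weyl_act_word_smult mult.commute)
qed (simp add: weyl_act_add smult_add_right)

lemma weyl_act_mult: "weyl_act (f * g) p = weyl_act f (weyl_act g p)"
proof (induction f rule: poly_mapping_single_add_induct)
  case (single v a)
  show ?case
  proof (induction g rule: poly_mapping_single_add_induct)
    case (single w b)
    then show ?case
      by (simp add: mult_single weyl_act_single plus_free_monoid_def weyl_act_word_append
          weyl_act_word_smult)
  next
    case (sum g h)
    then show ?case by (simp add: distrib_left weyl_act_add weyl_act_add_right)
  qed
next
  case (sum f h)
  then show ?case by (simp add: distrib_right weyl_act_add)
qed

lemma weyl_act_one: "weyl_act 1 p = p"
proof -
  have "weyl_act (Poly_Mapping.single 0 1) p = p"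
    by (simp only: weyl_act_single) (simp add: zero_free_monoid_def weyl_act_word_def)
  then show ?thesis by simp
qed

lemma weyl_act_ideal:
  assumes "f \<in> two_sided_ideal {weyl_relation}"
  shows "weyl_act f p = 0"
  using assms
proof (induction arbitrary: p rule: two_sided_ideal.induct)
  case (generator s r t)
  have "weyl_act weyl_relation q = 0" for q :: "'a poly"
    by (simp add: weyl_relation_def weyl_act_diff weyl_act_add weyl_act_mult weyl_act_one
        free_gen_def free_monom_def weyl_act_single weyl_act_word_def pderiv_pCons)
  moreover have "weyl_act r 0 = (0 :: 'a poly)"
    using weyl_act_smult[of r 0 0] by simp
  ultimately show ?case using generator by (simp add: weyl_act_mult)
qed (simp_all add: weyl_act_zero weyl_act_add)

lemma one_notin_weyl_ideal:
  "(1 :: (weyl_gen, 'a::field) free_algebra) \<notin> two_sided_ideal {weyl_relation}"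
  using weyl_act_ideal[of 1 "1 :: 'a poly"] by (auto simp: weyl_act_one)

quotient_type (overloaded) 'a weyl = "(weyl_gen, 'a::field) free_algebra" / weyl_cong
  by (rule equivp_weyl_cong)

instantiation weyl :: (field) ring_1
begin

lift_definition zero_weyl :: "'a weyl" is 0 .

lift_definition one_weyl :: "'a weyl" is 1 .

lift_definition plus_weyl :: "'a weyl \<Rightarrow> 'a weyl \<Rightarrow> 'a weyl" is "(+)"
  unfolding weyl_cong_def by (metis add_diff_add two_sided_ideal.add)

lift_definition uminus_weyl :: "'a weyl \<Rightarrow> 'a weyl" is uminus
  unfolding weyl_cong_def by (metis minus_diff_minus two_sided_ideal_uminus)

lift_definition minus_weyl :: "'a weyl \<Rightarrow> 'a weyl \<Rightarrow> 'a weyl" is "(-)"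
proof -
  fix f f' g g' :: "(weyl_gen, 'a) free_algebra"
  assume "weyl_cong f f'" "weyl_cong g g'"
  then have "(f - f') + - (g - g') \<in> two_sided_ideal {weyl_relation}"
    unfolding weyl_cong_def by (intro two_sided_ideal.add two_sided_ideal_uminus)
  then show "weyl_cong (f - g) (f' - g')"
    by (simp add: weyl_cong_def algebra_simps)
qed

lift_definition times_weyl :: "'a weyl \<Rightarrow> 'a weyl \<Rightarrow> 'a weyl" is "(*)"
proof -
  fix f f' g g' :: "(weyl_gen, 'a) free_algebra"
  assume "weyl_cong f f'" "weyl_cong g g'"
  then have "(f - f') * g + f' * (g - g') \<in> two_sided_ideal {weyl_relation}"
    unfolding weyl_cong_def
    by (intro two_sided_ideal.add two_sided_ideal_mult_left two_sided_ideal_mult_right)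
  then show "weyl_cong (f * g) (f' * g')"
    by (simp add: weyl_cong_def algebra_simps)
qed

instance
proof
  fix a b c :: "'a weyl"
  have eq: "weyl_cong f g" if "f = g" for f g :: "(weyl_gen, 'a) free_algebra"
    using that by (simp add: weyl_cong_def two_sided_ideal.zero)
  show "a + b + c = a + (b + c)" by transfer (rule eq, simp add: add.assoc)
  show "a + b = b + a" by transfer (rule eq, simp add: add.commute)
  show "0 + a = a" by transfer (rule eq, simp)
  show "- a + a = 0" by transfer (rule eq, simp)
  show "a - b = a + - b" by transfer (rule eq, simp)
  show "a * b * c = a * (b * c)" by transfer (rule eq, simp add: mult.assoc)
  show "(a + b) * c = a * c + b * c" by transfer (rule eq, simp add: distrib_right)
  show "a * (b + c) = a * b + a * c" by transfer (rule eq, simp add: distrib_left)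
  show "1 * a = a" by transfer (rule eq, simp)
  show "a * 1 = a" by transfer (rule eq, simp)
  show "(0 :: 'a weyl) \<noteq> 1"
    by transfer
      (use two_sided_ideal_uminus[of "- 1"] one_notin_weyl_ideal in \<open>auto simp: weyl_cong_def\<close>)
qed

end

lift_definition weyl_scale :: "'a::field \<Rightarrow> 'a weyl \<Rightarrow> 'a weyl" is free_scale
  unfolding weyl_cong_def
  by (metis free.scale_right_diff_distrib free_scale_conv_mult two_sided_ideal_mult_left)

interpretation weyl: vector_space weyl_scale
proof
  fix a b :: 'a and u v :: "'a weyl"
  have eq: "weyl_cong f g" if "f = g" for f g :: "(weyl_gen, 'a) free_algebra"
    using that by (simp add: weyl_cong_def two_sided_ideal.zero)
  show "weyl_scale a (u + v) = weyl_scale a u + weyl_scale a v"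
    by transfer (rule eq, rule free.scale_right_distrib)
  show "weyl_scale (a + b) u = weyl_scale a u + weyl_scale b u"
    by transfer (rule eq, rule free.scale_left_distrib)
  show "weyl_scale a (weyl_scale b u) = weyl_scale (a * b) u"
    by transfer (rule eq, rule free.scale_scale)
  show "weyl_scale 1 u = u"
    by transfer (rule eq, rule free.scale_one)
qed

lemma weyl_scale_mult_left: "weyl_scale c u * v = weyl_scale c (u * v)"
proof (transfer fixing: c)
  show "weyl_cong (free_scale c f * g) (free_scale c (f * g))"
    for f g :: "(weyl_gen, 'a) free_algebra"
    by (simp add: free_scale_conv_mult mult.assoc weyl_cong_def two_sided_ideal.zero)
qed

lemma weyl_scale_mult_right: "u * weyl_scale c v = weyl_scale c (u * v)"
proof (transfer fixing: c)
  show "weyl_cong (f * free_scale c g) (free_scale c (f * g))"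
    for f g :: "(weyl_gen, 'a) free_algebra"
    by (simp add: free_scale_mult_right weyl_cong_def two_sided_ideal.zero)
qed

lift_definition weyl_x :: "'a::field weyl" is "free_gen Gen_x" .

lift_definition weyl_y :: "'a::field weyl" is "free_gen Gen_y" .

lemma weyl_y_x: "weyl_y * weyl_x = weyl_x * weyl_y + (1 :: 'a::field weyl)"
proof transfer
  show "weyl_cong (free_gen Gen_y * free_gen Gen_x)
      (free_gen Gen_x * free_gen Gen_y + (1 :: (weyl_gen, 'a) free_algebra))"
    using two_sided_ideal.generator[of weyl_relation "{weyl_relation}" 1 1]
    by (simp add: weyl_cong_def weyl_relation_def)
qed

text \<open>The image of a polynomial under the canonical map from \<open>F[x]\<close> to the Weyl algebra.\<close>

definition weyl_of_poly :: "'a::field poly \<Rightarrow> 'a weyl"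
  where "weyl_of_poly p = (\<Sum>i\<le>degree p. weyl_scale (coeff p i) (weyl_x ^ i))"

text \<open>The subspace \<open>A\<^sub>1\<^bsup>(-,1)\<^esup>\<close>.\<close>

definition weyl_poly_y :: "'a::field weyl set"
  where "weyl_poly_y = weyl.span {weyl_of_poly p * weyl_y |p. True}"


section \<open>The polynomial of multidegree (2,2)\<close>

text \<open>Variables are indexed from 0: the paper's \<open>x\<^sub>1, x\<^sub>2\<close> are the generators 0 and 1.\<close>

definition Phi22 :: "(nat, 'a::field) free_algebra"
  where "Phi22 =
    (let x1 = free_gen 0; x2 = free_gen 1 in
      x1^2 * x2^2 - 3 * x1 * x2 * x1 * x2 + 2 * x1 * x2^2 * x1
      + 2 * x2 * x1^2 * x2 - 3 * x2 * x1 * x2 * x1 + x2^2 * x1^2)"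

end

theory Submission
  imports Defs
begin

text \<open>
  The substitution \<open>x\<^sub>1 \<mapsto> x y\<close>, \<open>x\<^sub>2 \<mapsto> (x + 1) y\<close> alone determines \<open>f\<close> up to a scalar, in every
  characteristic. Its value is read off in the representation of the Weyl algebra on \<open>F[t][x]\<close>
  where \<open>x\<close> acts by multiplication and \<open>y\<close> by \<open>d/dx + t\<close>. Applied to 1, an element in normal form
  gives its own symbol with \<open>t\<close> for \<open>y\<close>, so, unlike the action on \<open>F[x]\<close>, no information is lost
  in positive characteristic. The coefficients at \<open>x\<^sup>2 t\<^sup>4\<close>, \<open>x t\<^sup>3\<close>, \<open>x t\<^sup>2\<close>, \<open>t\<^sup>2\<close> and \<open>t\<close> give a
  system of linear equations for the six coefficients of \<open>f\<close> which has rank 5 over the integers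
  modulo every prime.
\<close>

lemma evaluate_superset:
  assumes "vector_space scale" "finite A" "Poly_Mapping.keys f \<subseteq> A"
  shows "evaluate scale a f =
    (\<Sum>w\<in>A. scale (Poly_Mapping.lookup f w) (prod_list (map a (letters w))))"
proof -
  interpret vector_space scale by fact
  show ?thesis
    unfolding evaluate_def
    by (rule sum.mono_neutral_left) (use assms in \<open>auto simp: in_keys_iff\<close>)
qed

lemma evaluate_add:
  assumes "vector_space scale"
  shows "evaluate scale a (f + g) = evaluate scale a f + evaluate scale a g"
proof -
  interpret vector_space scale by fact
  let ?A = "Poly_Mapping.keys f \<union> Poly_Mapping.keys g"
  have "Poly_Mapping.keys (f + g) \<subseteq> ?A" by (rule Poly_Mapping.keys_add)
  then show ?thesis
    using evaluate_superset[OF assms, of ?A _ a]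
    by (simp add: lookup_add scale_left_distrib sum.distrib)
qed

lemma evaluate_scale_monom:
  assumes "vector_space scale"
  shows "evaluate scale a (free_scale c (free_monom w)) = scale c (prod_list (map a w))"
proof -
  interpret vector_space scale by fact
  have "free_scale c (free_monom w) = Poly_Mapping.single (Word w) c"
    by (rule poly_mapping_eqI)
      (simp add: lookup_free_scale free_monom_def lookup_single when_def)
  then show ?thesis by (cases "c = 0") (simp_all add: evaluate_def)
qed


subsection \<open>Modules over the free algebra\<close>

text \<open>By freeness, an arbitrary family of linear operators indexed by the generators extends
  to a module structure. No relation between the operators is assumed; relations enter only through
  \<open>act_ideal\<close>.\<close>

locale free_module = vector_space scale
  for scale :: "'a::field \<Rightarrow> 'm::ab_group_add \<Rightarrow> 'm" +
  fixes op :: "'v \<Rightarrow> 'm \<Rightarrow> 'm"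
  assumes op_add: "op v (p + q) = op v p + op v q"
    and op_scale: "op v (scale c p) = scale c (op v p)"
begin

definition act :: "('v, 'a) free_algebra \<Rightarrow> 'm \<Rightarrow> 'm"
  where "act f p =
    (\<Sum>w \<in> Poly_Mapping.keys f. scale (Poly_Mapping.lookup f w) (foldr op (letters w) p))"

lemma foldr_op_add: "foldr op w (p + q) = foldr op w p + foldr op w q"
  by (induction w) (simp_all add: op_add)

lemma foldr_op_scale: "foldr op w (scale c p) = scale c (foldr op w p)"
  by (induction w) (simp_all add: op_scale)

lemma act_superset:
  assumes "finite A" "Poly_Mapping.keys f \<subseteq> A"
  shows "act f p = (\<Sum>w\<in>A. scale (Poly_Mapping.lookup f w) (foldr op (letters w) p))"
  unfolding act_def
  by (rule sum.mono_neutral_left) (use assms in \<open>auto simp: in_keys_iff\<close>)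

lemma act_add: "act (f + g) p = act f p + act g p"
proof -
  let ?A = "Poly_Mapping.keys f \<union> Poly_Mapping.keys g"
  have "Poly_Mapping.keys (f + g) \<subseteq> ?A" by (rule Poly_Mapping.keys_add)
  then show ?thesis
    using act_superset[of ?A _ p] by (simp add: lookup_add scale_left_distrib sum.distrib)
qed

lemma act_zero [simp]: "act 0 p = 0"
  by (simp add: act_def)

lemma act_diff: "act (f - g) p = act f p - act g p"
  using act_add[of "f - g" g p] by simp

lemma act_single: "act (Poly_Mapping.single w c) p = scale c (foldr op (letters w) p)"
  by (cases "c = 0") (simp_all add: act_def)

lemma act_one [simp]: "act 1 p = p"
proof -
  have "act (Poly_Mapping.single 0 1) p = p"
    by (simp only: act_single) (simp add: zero_free_monoid_def)
  then show ?thesis by simp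
qed

lemma act_gen [simp]: "act (free_gen v) p = op v p"
  by (simp add: free_gen_def free_monom_def act_single)

lemma act_add_right: "act f (p + q) = act f p + act f q"
  by (simp add: act_def foldr_op_add scale_right_distrib sum.distrib)

lemma act_zero_right [simp]: "act f 0 = 0"
  using act_add_right[of f 0 0] by simp

text \<open>Biadditivity reduces the claim to single words, where \<open>foldr\<close> turns
  concatenation into composition of operators.\<close>

lemma act_mult: "act (f * g) p = act f (act g p)"
proof (induction f rule: poly_mapping_single_add_induct)
  case (single v a)
  show ?case
  proof (induction g rule: poly_mapping_single_add_induct)
    case (single w b)
    then show ?case
      by (simp add: mult_single act_single plus_free_monoid_def foldr_op_scale)
  next
    case (sum g h)
    then show ?case by (simp add: distrib_left act_add act_add_right)
  qed
next
  case (sum f h)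
  then show ?case by (simp add: distrib_right act_add)
qed

lemma act_free_scale: "act (free_scale c f) p = scale c (act f p)"
  by (simp add: free_scale_conv_mult act_mult act_single zero_free_monoid_def)

text \<open>It suffices to check defining relations on all vectors; this lets the action descend to
  the quotient algebra.\<close>

lemma act_ideal:
  assumes "f \<in> two_sided_ideal S" and "\<And>s q. s \<in> S \<Longrightarrow> act s q = 0"
  shows "act f p = 0"
  using assms(1)
  by (induction arbitrary: p rule: two_sided_ideal.induct)
    (simp_all add: act_add act_mult assms(2))

end


subsection \<open>The representation of the Weyl algebra on \<open>F[t][x]\<close>\<close>

text \<open>The outer variable of \<open>'a poly poly\<close> is x and the inner one is t. Thus
  \<open>pderiv\<close> is d/dx with t constant, and \<open>[:0, 1:]\<close> is t.\<close>

primrec symbol_op :: "weyl_gen \<Rightarrow> 'a::field poly poly \<Rightarrow> 'a poly poly"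
  where
    "symbol_op Gen_x p = pCons 0 p"
  | "symbol_op Gen_y p = pderiv p + smult [:0, 1:] p"

interpretation symbol: free_module "\<lambda>c::'a::field. smult [:c:]" symbol_op
proof
  show "smult [:a:] (smult [:b:] p) = smult [:a * b:] p" for a b :: 'a and p
    by (simp add: mult.commute)
  show "smult [:a + b:] p = smult [:a:] p + smult [:b:] p" for a b :: 'a and p
    by (simp flip: smult_add_left)
  show "symbol_op v (p + q) = symbol_op v p + symbol_op v q" for v and p q :: "'a poly poly"
    by (cases v) (simp_all add: pderiv_add smult_add_right)
  show "symbol_op v (smult [:c:] p) = smult [:c:] (symbol_op v p)"
    for v and c :: 'a and p
    by (cases v) (simp_all add: pderiv_smult smult_add_right mult.commute)
qed (simp_all add: smult_add_right flip: one_pCons)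

lift_definition weyl_symbol :: "'a::field weyl \<Rightarrow> 'a poly poly \<Rightarrow> 'a poly poly"
  is symbol.act
proof -
  fix f g :: "(weyl_gen, 'a) free_algebra"
  assume "weyl_cong f g"
  then have "f - g \<in> two_sided_ideal {weyl_relation}" by (simp add: weyl_cong_def)
  \<comment> \<open>Since t commutes with x, the Leibniz rule gives (d/dx + t)(x q) = x (d/dx + t) q
    + q.\<close>
  moreover have "symbol.act weyl_relation q = 0" for q :: "'a poly poly"
    by (simp add: weyl_relation_def symbol.act_diff symbol.act_add symbol.act_mult pderiv_pCons)
  ultimately have "symbol.act (f - g) p = 0" for p
    by (auto intro: symbol.act_ideal)
  then show "symbol.act f = symbol.act g"
    by (simp add: symbol.act_diff fun_eq_iff)
qed

lemma weyl_symbol_zero: "weyl_symbol 0 p = 0"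
  by transfer simp

lemma weyl_symbol_one: "weyl_symbol 1 p = p"
  by transfer simp

lemma weyl_symbol_add: "weyl_symbol (u + v) p = weyl_symbol u p + weyl_symbol v p"
  by transfer (rule symbol.act_add)

lemma weyl_symbol_mult: "weyl_symbol (u * v) p = weyl_symbol u (weyl_symbol v p)"
  by transfer (rule symbol.act_mult)

lemma weyl_symbol_scale: "weyl_symbol (weyl_scale c u) p = smult [:c:] (weyl_symbol u p)"
  by transfer (rule symbol.act_free_scale)

lemma weyl_symbol_x: "weyl_symbol weyl_x p = pCons 0 p"
  by transfer simp

lemma weyl_symbol_y: "weyl_symbol weyl_y p = pderiv p + smult [:0, 1:] p"
  by transfer simp

lemmas weyl_symbol_simps = weyl_symbol_zero weyl_symbol_one weyl_symbol_add weyl_symbol_mult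
  weyl_symbol_scale weyl_symbol_x weyl_symbol_y


subsection \<open>Multidegree (2,2)\<close>

lemma has_multidegree_22:
  "{w. has_multidegree [2, 2] w} =
    {[0,0,1,1], [0,1,0,1], [0,1,1,0], [1,0,0,1], [1,0,1,0], [1,1,0,0]}"
proof (intro equalityI subsetI)
  fix w :: "nat list"
  assume "w \<in> {w. has_multidegree [2, 2] w}"
  then have set: "set w \<subseteq> {0, 1}" and c0: "count_list w 0 = 2" and c1: "count_list w 1 = 2"
    by (auto simp: has_multidegree_def numeral_2_eq_2 less_Suc_eq)
  \<comment> \<open>The two letters exhaust \<open>w\<close>, so the counts add up to length 4 and
    only 16 candidate words remain.\<close>
  have "length w = (\<Sum>i\<in>{0, 1}. count_list w i)"
    using set by (simp only: sum_count_set finite.intros)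
  then have "length w = Suc (Suc (Suc (Suc 0)))"
    using c0 c1 by simp
  then obtain a b c d where w: "w = [a, b, c, d]"
    by (auto simp: length_Suc_conv)
  with set have "a = 0 \<or> a = 1" "b = 0 \<or> b = 1" "c = 0 \<or> c = 1" "d = 0 \<or> d = 1"
    by auto
  then show "w \<in> {[0,0,1,1], [0,1,0,1], [0,1,1,0], [1,0,0,1], [1,0,1,0], [1,1,0,0]}"
    using c0 c1 unfolding w by (elim disjE) simp_all
qed (auto simp: has_multidegree_def less_Suc_eq numeral_2_eq_2)

lemma multihomogeneous_22E:
  fixes f :: "(nat, 'a::field) free_algebra"
  assumes "multihomogeneous [2, 2] f"
  obtains c0 c1 c2 c3 c4 c5 where
    "f = free_scale c0 (free_monom [0,0,1,1]) + free_scale c1 (free_monom [0,1,0,1])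
      + free_scale c2 (free_monom [0,1,1,0]) + free_scale c3 (free_monom [1,0,0,1])
      + free_scale c4 (free_monom [1,0,1,0]) + free_scale c5 (free_monom [1,1,0,0])"
proof -
  have "{free_monom w |w. has_multidegree [2, 2] w}
      = (free_monom ` {w. has_multidegree [2, 2] w} :: (nat, 'a) free_algebra set)"
    by auto
  with assms have "f \<in> free.span (free_monom `
      {[0,0,1,1], [0,1,0,1], [0,1,1,0], [1,0,0,1], [1,0,1,0], [1,1,0,0]})"
    by (simp only: multihomogeneous_def has_multidegree_22)
  \<comment> \<open>\<open>free.span_insert\<close> splits off one monomial at a time, each with its
    scalar, until the span of the empty set leaves 0.\<close>
  then obtain c0 c1 c2 c3 c4 c5 where
    "f - free_scale c0 (free_monom [0,0,1,1]) - free_scale c1 (free_monom [0,1,0,1])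
      - free_scale c2 (free_monom [0,1,1,0]) - free_scale c3 (free_monom [1,0,0,1])
      - free_scale c4 (free_monom [1,0,1,0]) - free_scale c5 (free_monom [1,1,0,0]) = 0"
    by (auto simp: free.span_insert)
  then show thesis
    by (intro that) (simp add: algebra_simps)
qed

lemma free_monom_mult: "free_monom v * free_monom w = free_monom (v @ w)"
  by (simp add: free_monom_def mult_single plus_free_monoid_def)

lemma numeral_mult_free: "numeral k * f = free_scale (numeral k) f"
  by (simp add: free_scale_conv_mult flip: single_numeral)

lemma free_scale_mult_left: "free_scale c f * g = free_scale c (f * g)"
  by (simp add: free_scale_conv_mult mult.assoc)

text \<open>This expansion uses the same six words as \<open>multihomogeneous_22E\<close>, so
  multiples of \<open>Phi22\<close> can be compared with \<open>f\<close> termwise.\<close>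

lemma Phi22_eq:
  "Phi22 = free_monom [0,0,1,1] - free_scale 3 (free_monom [0,1,0,1])
    + free_scale 2 (free_monom [0,1,1,0]) + free_scale 2 (free_monom [1,0,0,1])
    - free_scale 3 (free_monom [1,0,1,0]) + free_monom [1,1,0,0]"
  by (simp add: Phi22_def Let_def free_gen_def power2_eq_square mult.assoc free_monom_mult
      numeral_mult_free free_scale_mult_left)

theorem proposition3p4:
  fixes f :: "(nat, 'a::field) free_algebra"
  assumes "infinite (UNIV :: 'a set)"
    and "multihomogeneous [2, 2] f"
    and "polynomial_identity weyl_scale (weyl_poly_y :: 'a weyl set) f"
  shows "\<exists>\<alpha> :: 'a. f = free_scale \<alpha> Phi22"
proof -
  obtain c0 c1 c2 c3 c4 c5 where f:
    "f = free_scale c0 (free_monom [0,0,1,1]) + free_scale c1 (free_monom [0,1,0,1])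
      + free_scale c2 (free_monom [0,1,1,0]) + free_scale c3 (free_monom [1,0,0,1])
      + free_scale c4 (free_monom [1,0,1,0]) + free_scale c5 (free_monom [1,1,0,0])"
    using assms(2) by (rule multihomogeneous_22E)
  define u v :: "'a weyl" where "u = weyl_x * weyl_y" and "v = (weyl_x + 1) * weyl_y"
  have in_V: "weyl_of_poly p * weyl_y \<in> weyl_poly_y" for p :: "'a poly"
    unfolding weyl_poly_y_def by (rule weyl.span_base) auto
  have "u \<in> weyl_poly_y" "v \<in> weyl_poly_y"
    using in_V[of "[:0, 1:]"] in_V[of "[:1, 1:]"]
    by (simp_all add: u_def v_def weyl_of_poly_def add.commute)
  \<comment> \<open>An identity is tested on assignments of all generators, so every index other
    than 0 is sent to \<open>v\<close>.\<close>
  then have "evaluate weyl_scale (\<lambda>i. if i = 0 then u else v) f = 0"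
    using assms(3) by (auto simp: polynomial_identity_def)
  then have "weyl_symbol (weyl_scale c0 (u*(u*(v*v))) + weyl_scale c1 (u*(v*(u*v)))
      + weyl_scale c2 (u*(v*(v*u))) + weyl_scale c3 (v*(u*(u*v)))
      + weyl_scale c4 (v*(u*(v*u))) + weyl_scale c5 (v*(v*(u*u)))) 1 = 0"
    by (simp add: f evaluate_add[OF weyl.vector_space_axioms]
        evaluate_scale_monom[OF weyl.vector_space_axioms] weyl_symbol_zero)
  moreover have "weyl_symbol u p = pCons 0 (pderiv p + smult [:0, 1:] p)" for p
    by (simp add: u_def weyl_symbol_simps)
  moreover have "weyl_symbol v p =
      pCons 0 (pderiv p + smult [:0, 1:] p) + (pderiv p + smult [:0, 1:] p)" for p
    by (simp add: v_def weyl_symbol_simps)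
  \<comment> \<open>The second to fifth equations are the coefficients at t, t^2, x t^3 and x t^2.
    The first is the coefficient at x^2 t^4, the sum of all six unknowns, minus the one at
    t.\<close>
  ultimately have eqs: "c0 + c1 + c2 = 0" "c3 + c4 + c5 = 0" "c3 + 2 * c4 + 4 * c5 = 0"
    "c0 + 2 * c1 + 3 * c2 + 3 * c3 + 4 * c4 + 5 * c5 = 0"
    "3 * c0 + 5 * c1 + 6 * c2 + 8 * c3 + 9 * c4 + 11 * c5 = 0"
    by (auto simp: weyl_symbol_add weyl_symbol_mult weyl_symbol_scale pderiv_pCons algebra_simps)
  \<comment> \<open>Elimination meets only the pivots 1 and -1, so nothing is divided by 2 or 3. The
    free unknown \<open>c5\<close> becomes the scalar because its word has coefficient 1 in
    \<open>Phi22\<close>.\<close>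
  have "c4 = - 3 * c5" using eqs by algebra
  moreover have "c3 = 2 * c5" using eqs by algebra
  moreover have "c0 = c5" using eqs by algebra
  moreover have "c1 = - 3 * c5" using eqs by algebra
  moreover have "c2 = 2 * c5" using eqs by algebra
  ultimately have "f = free_scale c5 Phi22"
    by (simp add: f Phi22_eq free.scale_right_distrib free.scale_right_diff_distrib mult.commute)
  then show ?thesis ..
qed

end
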